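(* Let $n\ge3$ and $\mathcal{M}=\{a\in\mathbb{R}^n:\ \sum_{r=1}^n a_r^2=1,\ \sum_{r=1}^n a_r=0\}$. For every $3\le k\le n$, the function $(a_1,\dots,a_n)\in\mathcal{M}\mapsto e_k(a_1^2,\dots,a_n^2)$ attains its maximum over $\mathcal{M}$, when $n$ is even, at the vector $$\left(\underbrace{\tfrac{1}{\sqrt n},\dots,\tfrac1{\sqrt n}}_{n/2\text{ times}},\ \underbrace{-\tfrac{1}{\sqrt n},\dots,-\tfrac1{\sqrt n}}_{n/2\text{ times}}\right),$$ and, when $n$ is odd, at the vector $$\left(\underbrace{\sqrt{\tfrac{n+1}{n(n-1)}},\dots,\sqrt{\tfrac{n+1}{n(n-1)}}}_{\frac{n-1}{2}\text{ times}},\ \underbrace{-\sqrt{\tfrac{n-1}{n(n+1)}},\dots,-\sqrt{\tfrac{n-1}{n(n+1)}}}_{\frac{n+1}{2}\text{ times}}\right).$$ Moreover, for every $3\le k\le n$, the minimum value over $\mathcal{M}$ is equal to $0$, and it is attained at $\left(\frac1{\sqrt2},-\frac1{\sqrt2},0,\dots,0\right)$.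
   Context: $e_k(x_1,\dots,x_n)=\sum_{1\le i_1<\cdots<i_k\le n}x_{i_1}\cdots x_{i_k}$ is the $k$-th elementary symmetric polynomial. *)

theory Defs
  imports "HOL-Analysis.Analysis"
begin

(* Points of R^n are real functions on the index set {1..n}, in the extensional
   form of HOL-Library.FuncSet (value undefined outside {1..n}), so that each
   point has exactly one representative. *)

definition zero_sum_sphere :: "nat \<Rightarrow> (nat \<Rightarrow> real) set" where
  "zero_sum_sphere n =
     {a \<in> {1..n} \<rightarrow>\<^sub>E UNIV. (\<Sum>r\<in>{1..n}. (a r)\<^sup>2) = 1 \<and> (\<Sum>r\<in>{1..n}. a r) = 0}"

(* The index tuples i_1 < ... < i_k from {1..n} are encoded as the k-element
   subsets of {1..n}. *)

definition elem_sym :: "nat \<Rightarrow> nat \<Rightarrow> (nat \<Rightarrow> real) \<Rightarrow> real" where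
  "elem_sym n k x = (\<Sum>S | S \<subseteq> {1..n} \<and> card S = k. \<Prod>i\<in>S. x i)"

end

(* Fix all but three coordinates x, y, z of a maximizer. With x + y + z and
   xy + yz + zx fixed, e_k of the squares is a strictly convex quadratic function of xyz,
   and xyz can be moved in both directions when x, y, z are distinct. So a maximizer
   (which exists by compactness) has only two values, one positive and one negative; if the
   positive one is taken p times, the squares are (n-p)/(np) and p/(n(n-p)). For
   p <= m = n div 2 this vector of squares majorizes the one for m, and e_k is
   Schur-concave on nonnegative vectors; p and n-p give the same squares. *)
theory Submission
  imports Defs "HOL-Computational_Algebra.Polynomial"
begin

section \<open>Generating polynomial of the elementary symmetric sums\<close>

text \<open>The product of the factors 1 + x_i t, whose coefficient at t^k is e_k. Adding or
  removing an index is multiplication or division by a linear factor, and an arbitrary index set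
  \<open>A\<close> lets chosen coordinates be split off.\<close>

definition esp_poly :: "'a set \<Rightarrow> ('a \<Rightarrow> real) \<Rightarrow> real poly" where
  "esp_poly A x = (\<Prod>i\<in>A. [:1, x i:])"

lemma esp_poly_empty [simp]: "esp_poly {} x = 1"
  by (simp add: esp_poly_def)

lemma esp_poly_cong: "(\<And>i. i \<in> A \<Longrightarrow> x i = y i) \<Longrightarrow> esp_poly A x = esp_poly A y"
  unfolding esp_poly_def by (rule prod.cong) auto

lemma coeff_linear_mult:
  fixes t :: real
  shows "coeff ([:1, t:] * p) k = coeff p k + (if k = 0 then 0 else t * coeff p (k - 1))"
  by (cases k) (auto simp: coeff_pCons)

lemma coeff_esp_poly_insert:
  assumes "finite A" "i \<notin> A"
  shows "coeff (esp_poly (insert i A) x) k =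
    coeff (esp_poly A x) k + (if k = 0 then 0 else x i * coeff (esp_poly A x) (k - 1))"
  using assms by (simp add: esp_poly_def coeff_linear_mult del: mult_pCons_left)

lemma coeff_esp_poly_remove:
  assumes "finite A" "i \<in> A"
  shows "coeff (esp_poly A x) k =
    coeff (esp_poly (A - {i}) x) k +
    (if k = 0 then 0 else x i * coeff (esp_poly (A - {i}) x) (k - 1))"
  using coeff_esp_poly_insert[of "A - {i}" i x k] assms by (simp add: insert_absorb)

text \<open>The k-subsets of \<open>insert i A\<close> split into those avoiding \<open>i\<close>
  and those containing it. The latter are the (k-1)-subsets of \<open>A\<close> with
  \<open>i\<close> added, which is the recursion for multiplication by 1 + x_i t.\<close>

lemma coeff_esp_poly:
  assumes "finite A"
  shows "coeff (esp_poly A x) k = (\<Sum>S | S \<subseteq> A \<and> card S = k. \<Prod>i\<in>S. x i)"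
  using assms
proof (induction A arbitrary: k rule: finite_induct)
  case empty
  have "{S. S \<subseteq> {} \<and> card S = k} = (if k = 0 then {{}} else ({} :: 'a set set))"
    by auto
  then show ?case by (simp only: esp_poly_empty) simp
next
  case (insert i A)
  show ?case
  proof (cases k)
    case 0
    \<comment> \<open>\<open>card\<close> is also 0 on infinite sets, so finiteness of
      \<open>B\<close> is what leaves only the empty subset.\<close>
    have *: "{S. S \<subseteq> B \<and> card S = 0} = {{}}" if "finite B" for B :: "'a set"
      using that by (auto dest: finite_subset)
    show ?thesis
      using insert by (simp add: 0 coeff_esp_poly_insert * del: card_eq_0_iff)
  next
    case (Suc j)
    let ?F = "\<lambda>j. {S. S \<subseteq> A \<and> card S = j}"
    have fin: "finite (?F j)" for j
      using insert.hyps by simp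
    have split: "{S. S \<subseteq> insert i A \<and> card S = Suc j} = ?F (Suc j) \<union> Set.insert i ` ?F j"
      (is "?L = ?R")
    proof
      show "?R \<subseteq> ?L"
      proof -
        have "finite S \<and> i \<notin> S" if "S \<subseteq> A" for S
          using that insert.hyps by (auto intro: finite_subset)
        then show ?thesis by (auto simp: card_insert_disjoint)
      qed
      show "?L \<subseteq> ?R"
      proof
        fix S assume S: "S \<in> ?L"
        show "S \<in> ?R"
        proof (cases "i \<in> S")
          case True
          then have "S - {i} \<in> ?F j" "S = Set.insert i (S - {i})"
            using S by auto
          then show ?thesis by blast
        qed (use S in auto)
      qed
    qed
    have inj: "inj_on (Set.insert i) (?F j)"
      using insert.hyps by (auto simp: inj_on_def)
    have "(\<Sum>S | S \<subseteq> insert i A \<and> card S = k. \<Prod>i\<in>S. x i) =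
        (\<Sum>S\<in>?F (Suc j). \<Prod>i\<in>S. x i) + (\<Sum>S\<in>Set.insert i ` ?F j. \<Prod>i\<in>S. x i)"
      unfolding Suc split using insert.hyps fin by (intro sum.union_disjoint) auto
    also have "(\<Sum>S\<in>Set.insert i ` ?F j. \<Prod>i\<in>S. x i) = (\<Sum>S\<in>?F j. \<Prod>i\<in>Set.insert i S. x i)"
      using inj by (simp add: sum.reindex)
    also have "\<dots> = (\<Sum>S\<in>?F j. x i * (\<Prod>i\<in>S. x i))"
      using insert.hyps by (intro sum.cong refl prod.insert) (auto dest: finite_subset)
    also have "\<dots> = x i * (\<Sum>S\<in>?F j. \<Prod>i\<in>S. x i)"
      by (simp add: sum_distrib_left)
    finally show ?thesis
      using insert Suc by (simp add: coeff_esp_poly_insert)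
  qed
qed

lemma coeff_esp_poly_nonneg:
  assumes "finite A" "\<And>i. i \<in> A \<Longrightarrow> 0 \<le> x i"
  shows "0 \<le> coeff (esp_poly A x) k"
  using assms
  by (auto simp: coeff_esp_poly intro!: sum_nonneg prod_nonneg)

lemma coeff_esp_poly_pos:
  assumes "finite A" "\<And>i. i \<in> A \<Longrightarrow> 0 < x i" "k \<le> card A"
  shows "0 < coeff (esp_poly A x) k"
proof -
  obtain S where "S \<subseteq> A" "card S = k"
    using obtain_subset_with_card_n[OF assms(3)] by metis
  then show ?thesis
    unfolding coeff_esp_poly[OF assms(1)] using assms(1,2)
    by (intro sum_pos prod_pos) auto
qed

text \<open>If e_k vanishes on nonnegative numbers, fewer than k of them are positive, so e_(k+1)
  vanishes as well. In the induction, a zero sum of nonnegative terms forces the part without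
  \<open>i\<close> to vanish.\<close>

lemma coeff_esp_poly_zero_Suc:
  assumes "finite A" "\<And>i. i \<in> A \<Longrightarrow> 0 \<le> x i" "coeff (esp_poly A x) k = 0"
  shows "coeff (esp_poly A x) (Suc k) = 0"
  using assms
proof (induction A arbitrary: k rule: finite_induct)
  case empty
  then show ?case by (simp add: coeff_eq_0)
next
  case (insert i A)
  have nn: "0 \<le> coeff (esp_poly A x) j" for j
    using insert by (intro coeff_esp_poly_nonneg) auto
  have "0 \<le> (if k = 0 then 0 else x i * coeff (esp_poly A x) (k - 1))"
    using insert.prems(1) nn by simp
  then have "coeff (esp_poly A x) k = 0"
    using insert.prems(2) nn[of k] insert.hyps by (simp add: coeff_esp_poly_insert)
  moreover from this have "coeff (esp_poly A x) (Suc k) = 0"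
    using insert by auto
  ultimately show ?case
    using insert.hyps by (simp add: coeff_esp_poly_insert)
qed

section \<open>Transfers between two coordinates and Schur-concavity\<close>

text \<open>With x_i + x_j and the other coordinates fixed, e_k is affine in the product x_i x_j,
  and its slope is e_(k-2) of the other coordinates, which is nonnegative.\<close>

lemma coeff_esp_poly_transfer_le:
  assumes "finite A" "i \<in> A" "j \<in> A" "i \<noteq> j" "\<And>l. l \<in> A \<Longrightarrow> 0 \<le> x l"
    and "\<And>l. l \<in> A - {i, j} \<Longrightarrow> x l = y l"
    and "x i + x j = y i + y j" "x i * x j \<le> y i * y j"
  shows "coeff (esp_poly A x) k \<le> coeff (esp_poly A y) k"
proof -
  let ?R = "A - {i} - {j}"
  define Q where "Q = esp_poly ?R x"
  have y: "esp_poly ?R y = Q"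
    unfolding Q_def using assms(6) by (intro esp_poly_cong) simp
  have Q: "0 \<le> coeff Q l" for l
    unfolding Q_def using assms(1,5) by (intro coeff_esp_poly_nonneg) auto
  \<comment> \<open>The conditionals remove the terms in which the truncated differences
    \<open>k - 1\<close> and \<open>k - 2\<close> would not be the true indices.\<close>
  have expand: "coeff (esp_poly A z) k = coeff Q k +
      (if k = 0 then 0 else (z i + z j) * coeff Q (k - 1)) +
      (if k \<le> 1 then 0 else z i * z j * coeff Q (k - 2))"
    if "esp_poly ?R z = Q" for z
  proof -
    have "coeff (esp_poly (A - {i}) z) l = coeff Q l + (if l = 0 then 0 else z j * coeff Q (l - 1))" for l
      using coeff_esp_poly_remove[of "A - {i}" j z l] assms that by simp
    then show ?thesis
      using coeff_esp_poly_remove[of A i z k] assms(1,2)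
      by (auto simp: algebra_simps numeral_2_eq_2)
  qed
  show ?thesis
    unfolding expand[OF y] expand[OF Q_def[symmetric]] assms(7)
    using Q assms(8) by (auto intro: mult_right_mono)
qed

text \<open>A special case of Schur-concavity: \<open>x\<close> has its surpluses over
  \<open>y\<close> in \<open>U\<close> and its deficits in \<open>V\<close>, and \<open>y\<close> is
  at least as large on \<open>U\<close> as on \<open>V\<close>. Moving mass from a surplus to a
  deficit never lowers e_k and never reverses the order of the two entries. The number of indices
  where \<open>x\<close> and \<open>y\<close> differ drops each time.\<close>

lemma coeff_esp_poly_majorized_le:
  assumes "finite A" "A = U \<union> V"
    and "\<And>i. i \<in> A \<Longrightarrow> 0 \<le> x i"
    and "\<And>i. i \<in> U \<Longrightarrow> y i \<le> x i" "\<And>j. j \<in> V \<Longrightarrow> x j \<le> y j"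
    and "\<And>i j. i \<in> U \<Longrightarrow> j \<in> V \<Longrightarrow> y j \<le> y i"
    and "sum x A = sum y A"
  shows "coeff (esp_poly A x) k \<le> coeff (esp_poly A y) k"
  using assms(3-)
proof (induction "card {i\<in>A. x i \<noteq> y i}" arbitrary: x rule: less_induct)
  case less
  show ?case
  proof (cases "\<forall>i\<in>A. x i = y i")
    case True
    then show ?thesis
      using esp_poly_cong[of A x y] by simp
  next
    case False
    have "\<exists>i\<in>A. y i < x i"
    proof (rule ccontr)
      assume "\<not> ?thesis"
      then have "\<forall>i\<in>A. x i \<le> y i" "\<exists>i\<in>A. x i < y i"
        using False by (force simp: not_less)+
      then have "sum x A < sum y A"
        using \<open>finite A\<close> by (intro sum_strict_mono_ex1) auto
      then show False using less.prems by simp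
    qed
    then obtain i where i: "i \<in> A" "y i < x i" by blast
    then have iU: "i \<in> U" using less.prems(3)[of i] assms(2) by force
    have "\<exists>i\<in>A. x i < y i"
    proof (rule ccontr)
      assume "\<not> ?thesis"
      then have "\<forall>i\<in>A. y i \<le> x i" "\<exists>i\<in>A. y i < x i"
        using False by (force simp: not_less)+
      then have "sum y A < sum x A"
        using \<open>finite A\<close> by (intro sum_strict_mono_ex1) auto
      then show False using less.prems by simp
    qed
    then obtain j where j: "j \<in> A" "x j < y j" by blast
    then have jV: "j \<in> V" using less.prems(2)[of j] assms(2) by force
    have ij: "i \<noteq> j" using i j by auto
    \<comment> \<open>The smaller of surplus and deficit: one of the two coordinates reaches its
      target and the other does not pass it, so the hypotheses persist.\<close>
    define \<delta> where "\<delta> = min (x i - y i) (y j - x j)"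
    define x' where "x' = x(i := x i - \<delta>, j := x j + \<delta>)"
    have \<delta>: "0 < \<delta>" "y i \<le> x i - \<delta>" "x j + \<delta> \<le> y j" "\<delta> = x i - y i \<or> \<delta> = y j - x j"
      unfolding \<delta>_def using i j by (auto simp: min_def)
    have x': "x' i = x i - \<delta>" "x' j = x j + \<delta>" "\<And>l. l \<noteq> i \<Longrightarrow> l \<noteq> j \<Longrightarrow> x' l = x l"
      unfolding x'_def using ij by auto
    have yij: "y j \<le> y i" using less.prems(4) iU jV by auto
    have pair: "sum f A = sum f (A - {i, j}) + f i + f j" for f :: "'a \<Rightarrow> real"
    proof -
      have "A - {i} - {j} = A - {i, j}" by auto
      then show ?thesis
        using \<open>finite A\<close> i j ij by (simp add: sum.remove[of A i] sum.remove[of "A - {i}" j])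
    qed
    have "coeff (esp_poly A x) k \<le> coeff (esp_poly A x') k"
    proof (rule coeff_esp_poly_transfer_le[OF \<open>finite A\<close> i(1) j(1) ij less.prems(1)])
      \<comment> \<open>This is the increase of the product x_i x_j. It is nonnegative because x_i -
        \<delta> >= y_i >= y_j >= x_j + \<delta>.\<close>
      have "0 \<le> \<delta> * (x i - \<delta> - x j)"
        using \<delta> yij by (intro mult_nonneg_nonneg) auto
      then show "x i * x j \<le> x' i * x' j"
        by (simp add: x' algebra_simps)
    qed (auto simp: x')
    also have "\<dots> \<le> coeff (esp_poly A y) k"
    proof (rule less.hyps)
      have "{l\<in>A. x' l \<noteq> y l} \<subseteq> {l\<in>A. x l \<noteq> y l}"
      proof clarify
        fix l assume "x' l \<noteq> y l" "x l = y l"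
        then show False using i j x'(3)[of l] by (cases "l = i"; cases "l = j") auto
      qed
      moreover have "i \<notin> {l\<in>A. x' l \<noteq> y l} \<or> j \<notin> {l\<in>A. x' l \<noteq> y l}"
        using \<delta>(4) x' by auto
      ultimately have "{l\<in>A. x' l \<noteq> y l} \<subset> {l\<in>A. x l \<noteq> y l}"
        using i j by auto
      then show "card {l\<in>A. x' l \<noteq> y l} < card {l\<in>A. x l \<noteq> y l}"
        using \<open>finite A\<close> by (intro psubset_card_mono) auto
      have "sum x' (A - {i, j}) = sum x (A - {i, j})"
        by (intro sum.cong) (auto simp: x')
      then have "sum x' A = sum x A"
        by (simp add: pair x')
      then show "sum x' A = sum y A"
        using less.prems by simp
      show "0 \<le> x' l" if "l \<in> A" for l
        using that less.prems(1)[of l] less.prems(1)[OF j(1)] \<delta> yij j x' by (cases "l = i"; cases "l = j") auto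
      show "y l \<le> x' l" if "l \<in> U" for l
        using that less.prems(2)[of l] \<delta> j x' less.prems(2)[of j] by (cases "l = i"; cases "l = j") auto
      show "x' l \<le> y l" if "l \<in> V" for l
        using that less.prems(3)[of l] \<delta> i x' less.prems(3)[of i] by (cases "l = i"; cases "l = j") auto
    qed (use less.prems(4) in auto)
    finally show ?thesis .
  qed
qed

section \<open>Moving three distinct numbers with sum and pair sum fixed\<close>

text \<open>Replace \<open>x\<close> by \<open>x + h\<close> and let the prescribed sum and pair sum
  determine the other two numbers as roots of a quadratic. Distinctness keeps these roots real for
  small \<open>h\<close> and lets the sign of \<open>h\<close> decide the direction in which the
  product moves. A strictly convex quadratic in the product then increases strictly in a suitable
  direction.\<close>

lemma triple_perturbation:
  fixes x y z D K :: real
  assumes "x \<noteq> y" "x \<noteq> z" "y \<noteq> z" "0 < D"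
  obtains x' y' z' where "x' + y' + z' = x + y + z" "x' * y' + y' * z' + z' * x' = x * y + y * z + z * x"
    "D * (x * y * z)\<^sup>2 + K * (x * y * z) < D * (x' * y' * z')\<^sup>2 + K * (x' * y' * z')"
proof -
  \<comment> \<open>\<open>disc h\<close> is the discriminant of the quadratic for the new
    \<open>y'\<close> and \<open>z'\<close>. The new product exceeds the old one by p(x + h) =
    \<open>h * w h\<close>, where p is the monic cubic with roots x, y, z.\<close>
  define disc where "disc h = (y - z)\<^sup>2 + h * (2 * (y + z) - 4 * x) - 3 * h\<^sup>2" for h
  define w where "w h = (h + x - y) * (h + x - z)" for h
  have "isCont disc 0" "isCont (\<lambda>h. w h * w 0) 0"
    unfolding disc_def w_def by (intro continuous_intros)+
  then have lim: "disc \<midarrow>0\<rightarrow> disc 0" "(\<lambda>h. w h * w 0) \<midarrow>0\<rightarrow> w 0 * w 0"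
    unfolding isCont_def .
  have "0 < disc 0" "w 0 \<noteq> 0"
    using assms by (simp_all add: disc_def w_def)
  then have w0: "0 < w 0 * w 0"
    by (auto simp: zero_less_mult_iff)
  have "\<forall>\<^sub>F h in at 0. 0 < disc h" "\<forall>\<^sub>F h in at 0. 0 < w h * w 0"
    using order_tendstoD(1)[OF lim(1) \<open>0 < disc 0\<close>] order_tendstoD(1)[OF lim(2) w0] .
  then have "\<forall>\<^sub>F h in at 0. 0 < disc h \<and> 0 < w h * w 0"
    by (rule eventually_conj)
  then obtain d where d: "0 < d" "\<And>h. h \<noteq> 0 \<Longrightarrow> \<bar>h\<bar> < d \<Longrightarrow> 0 < disc h \<and> 0 < w h * w 0"
    unfolding eventually_at by (auto simp: dist_real_def)
  \<comment> \<open>\<open>C\<close> is the derivative of D t^2 + K t at t = xyz. The sign of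
    \<open>h\<close> is chosen so that the linear part \<open>C * u\<close> of the change is
    nonnegative; for this \<open>w h\<close> must have the sign of \<open>w 0\<close>.\<close>
  define C where "C = 2 * D * (x * y * z) + K"
  define h where "h = (if 0 \<le> C * w 0 then d / 2 else - (d / 2))"
  have h: "h \<noteq> 0" "\<bar>h\<bar> < d" "0 \<le> C * w 0 * h"
    using d(1) by (auto simp: h_def mult_le_0_iff zero_le_mult_iff)
  have dh: "0 < disc h" "0 < w h * w 0"
    using d(2)[OF h(1,2)] by auto
  define x' where "x' = x + h"
  define y' where "y' = (y + z - h + sqrt (disc h)) / 2"
  define z' where "z' = (y + z - h - sqrt (disc h)) / 2"
  have yz: "y' + z' = y + z - h"
    by (simp add: y'_def z'_def field_simps)
  have "y' * z' = ((y + z - h)\<^sup>2 - (sqrt (disc h))\<^sup>2) / 4"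
    by (simp add: y'_def z'_def power2_eq_square algebra_simps)
  also have "\<dots> = y * z + x * h - h * (y + z) + h\<^sup>2"
    using dh(1) by (simp add: disc_def power2_eq_square field_simps)
  finally have yz': "y' * z' = y * z + x * h - h * (y + z) + h\<^sup>2" .
  define u where "u = h * w h"
  have e3: "x' * y' * z' = x * y * z + u"
    unfolding u_def w_def x'_def mult.assoc yz' by (simp add: power2_eq_square algebra_simps)
  have "u \<noteq> 0"
    using h(1) dh(2) by (auto simp: u_def)
  then have "0 < D * u\<^sup>2"
    using assms(4) by simp
  moreover have "0 \<le> C * u"
  proof -
    have "0 \<le> (C * w 0 * h) * (w h * w 0)"
      using h(3) dh(2) by simp
    also have "\<dots> = (C * u) * (w 0 * w 0)"
      by (simp add: u_def)
    finally show ?thesis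
      using w0 by (simp add: zero_le_mult_iff)
  qed
  ultimately have "0 < D * u\<^sup>2 + C * u"
    by simp
  then have "D * (x * y * z)\<^sup>2 + K * (x * y * z) < D * (x' * y' * z')\<^sup>2 + K * (x' * y' * z')"
    unfolding e3 C_def by (simp add: power2_eq_square algebra_simps)
  moreover have "x' + y' + z' = x + y + z"
    using yz by (simp add: x'_def)
  moreover have "x' * y' + y' * z' + z' * x' = x * y + y * z + z * x"
  proof -
    have "x' * y' + y' * z' + z' * x' = x' * (y' + z') + y' * z'"
      by (simp add: algebra_simps)
    then show ?thesis
      unfolding yz yz' x'_def by (simp add: power2_eq_square algebra_simps)
  qed
  ultimately show thesis using that by blast
qed

section \<open>Compactness of the constraint set and existence of a maximizer\<close>

lemma elem_sym_eq_coeff: "elem_sym n k x = coeff (esp_poly {1..n} x) k"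
  by (simp add: elem_sym_def coeff_esp_poly)

lemma elem_sym_nonneg: "(\<And>i. 0 \<le> x i) \<Longrightarrow> 0 \<le> elem_sym n k x"
  by (simp add: elem_sym_eq_coeff coeff_esp_poly_nonneg)

text \<open>Coordinates in \<open>{1..n}\<close> are bounded by 1 and all others are pinned to
  \<open>undefined\<close>. The set is therefore a closed subset of a product of intervals and
  singletons, which is compact by Tychonoff.\<close>

lemma compact_zero_sum_sphere: "compact (zero_sum_sphere n)"
proof -
  define C :: "nat \<Rightarrow> real set" where "C i = (if i \<in> {1..n} then {-1..1} else {undefined})" for i
  have "compactin (product_topology (\<lambda>i. euclidean) UNIV) (PiE UNIV C)"
    unfolding compactin_PiE by (auto simp: C_def)
  then have "compact (PiE UNIV C)"
    by (simp add: euclidean_product_topology)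
  moreover have "closed {a :: nat \<Rightarrow> real. (\<Sum>r\<in>{1..n}. (a r)\<^sup>2) = 1}"
    "closed {a :: nat \<Rightarrow> real. (\<Sum>r\<in>{1..n}. a r) = 0}"
    by (intro closed_Collect_eq continuous_intros continuous_on_product_coordinates)+
  moreover have "zero_sum_sphere n =
      PiE UNIV C \<inter> {a. (\<Sum>r\<in>{1..n}. (a r)\<^sup>2) = 1} \<inter> {a. (\<Sum>r\<in>{1..n}. a r) = 0}"
  proof -
    have "a i \<in> {-1..1}" if "(\<Sum>r\<in>{1..n}. (a r)\<^sup>2) = 1" "i \<in> {1..n}" for a :: "nat \<Rightarrow> real" and i
    proof -
      have "(a i)\<^sup>2 \<le> 1"
        using member_le_sum[of i "{1..n}" "\<lambda>r. (a r)\<^sup>2"] that by auto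
      then show ?thesis
        by (auto simp: abs_square_le_1 abs_le_iff)
    qed
    then show ?thesis
      by (fastforce simp: zero_sum_sphere_def C_def PiE_def Pi_def extensional_def split: if_splits)
  qed
  ultimately show ?thesis
    by (auto intro!: compact_Int_closed)
qed

lemma elem_sym_squares_attains_max:
  assumes "zero_sum_sphere n \<noteq> {}"
  obtains a where "a \<in> zero_sum_sphere n"
    "\<And>b. b \<in> zero_sum_sphere n \<Longrightarrow> elem_sym n k (\<lambda>r. (b r)\<^sup>2) \<le> elem_sym n k (\<lambda>r. (a r)\<^sup>2)"
proof -
  have "continuous_on (zero_sum_sphere n) (\<lambda>a. elem_sym n k (\<lambda>r. (a r)\<^sup>2))"
    unfolding elem_sym_def
    by (intro continuous_intros continuous_on_subset[OF continuous_on_product_coordinates]) auto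
  from continuous_attains_sup[OF compact_zero_sum_sphere assms this]
  show thesis using that by blast
qed

section \<open>Shape of a maximizer\<close>

text \<open>Let s1, s2, s3 be the elementary symmetric functions of three entries. Those of their
  squares are s1^2 - 2 s2, s2^2 - 2 s1 s3 and s3^2. For fixed s1 and s2 the objective is thus a
  quadratic in s3, and \<open>triple_perturbation\<close> would improve it at three distinct
  values.\<close>

lemma maximizer_not_three_values:
  assumes "3 \<le> k" and a: "a \<in> zero_sum_sphere n"
    and max: "\<And>b. b \<in> zero_sum_sphere n \<Longrightarrow> elem_sym n k (\<lambda>r. (b r)\<^sup>2) \<le> elem_sym n k (\<lambda>r. (a r)\<^sup>2)"
    and pos: "0 < elem_sym n k (\<lambda>r. (a r)\<^sup>2)"
    and ijl: "i \<in> {1..n}" "j \<in> {1..n}" "l \<in> {1..n}"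
  shows "a i = a j \<or> a i = a l \<or> a j = a l"
proof (rule ccontr)
  assume "\<not> ?thesis"
  then have ne: "a i \<noteq> a j" "a i \<noteq> a l" "a j \<noteq> a l" by auto
  then have ijl_ne: "i \<noteq> j" "i \<noteq> l" "j \<noteq> l" by auto
  define I where "I = {1..n}"
  define R where "R = I - {i} - {j} - {l}"
  have I: "finite I" "i \<in> I" "j \<in> I - {i}" "l \<in> I - {i} - {j}"
    using ijl ijl_ne by (auto simp: I_def)
  define E where "E m = coeff (esp_poly R (\<lambda>r. (a r)\<^sup>2)) m" for m
  \<comment> \<open>Writing \<open>k\<close> as a threefold successor makes \<open>k - 1\<close>,
    \<open>k - 2\<close>, \<open>k - 3\<close> true differences, so the expansion below needs no
    case distinction.\<close>
  obtain k' where k': "k = Suc (Suc (Suc k'))"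
    using \<open>3 \<le> k\<close> by (metis One_nat_def add_2_eq_Suc' le_add_diff_inverse numeral_3_eq_3 plus_1_eq_Suc add.commute add_Suc)
  define F where "F x y z = E k + (x + y + z) * E (k - 1) + (x * y + y * z + z * x) * E (k - 2) +
      x * y * z * E (k - 3)" for x y z
  have expand: "elem_sym n k (\<lambda>r. (b r)\<^sup>2) = F ((b i)\<^sup>2) ((b j)\<^sup>2) ((b l)\<^sup>2)"
    if "\<And>r. r \<in> R \<Longrightarrow> b r = a r" for b
  proof -
    let ?x = "\<lambda>r. (b r)\<^sup>2"
    have R: "coeff (esp_poly R ?x) m = E m" for m
      unfolding E_def using that by (intro arg_cong2[where f=coeff] esp_poly_cong) auto
    have l: "coeff (esp_poly (I - {i} - {j}) ?x) m = E m + (if m = 0 then 0 else ?x l * E (m - 1))" for m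
      using coeff_esp_poly_remove[of "I - {i} - {j}" l ?x m] I R by (simp add: R_def)
    have j: "coeff (esp_poly (I - {i}) ?x) (Suc m) =
        coeff (esp_poly (I - {i} - {j}) ?x) (Suc m) + ?x j * coeff (esp_poly (I - {i} - {j}) ?x) m" for m
      using coeff_esp_poly_remove[of "I - {i}" j ?x "Suc m"] I by simp
    have i: "coeff (esp_poly I ?x) (Suc m) =
        coeff (esp_poly (I - {i}) ?x) (Suc m) + ?x i * coeff (esp_poly (I - {i}) ?x) m" for m
      using coeff_esp_poly_remove[of I i ?x "Suc m"] I by simp
    show ?thesis
      unfolding elem_sym_eq_coeff F_def k' I_def[symmetric] i j l
      by (simp add: algebra_simps numeral_2_eq_2 numeral_3_eq_3)
  qed
  have E_nonneg: "0 \<le> E m" for m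
    unfolding E_def R_def I_def by (intro coeff_esp_poly_nonneg) auto
  \<comment> \<open>This is the leading coefficient of the quadratic. If it vanished, so would every
    later \<open>E m\<close> up to \<open>E k\<close>, and the objective would be 0 at
    \<open>a\<close>, against \<open>pos\<close>.\<close>
  have "E (k - 3) \<noteq> 0"
  proof
    assume 0: "E (k - 3) = 0"
    have Suc0: "E m = 0 \<Longrightarrow> E (Suc m) = 0" for m
      unfolding E_def R_def I_def by (intro coeff_esp_poly_zero_Suc) auto
    have "E k' = 0" "E (Suc k') = 0" "E (Suc (Suc k')) = 0" "E (Suc (Suc (Suc k'))) = 0"
      using 0 by (auto simp: k' intro!: Suc0)
    then have "F ((a i)\<^sup>2) ((a j)\<^sup>2) ((a l)\<^sup>2) = 0"
      by (simp add: F_def k' numeral_2_eq_2)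
    then show False
      using pos expand[of a] by simp
  qed
  then have D: "0 < E (k - 3)" using E_nonneg[of "k - 3"] by simp
  define K where "K = - 2 * (a i + a j + a l) * E (k - 2)"
  obtain x y z where xyz: "x + y + z = a i + a j + a l"
    "x * y + y * z + z * x = a i * a j + a j * a l + a l * a i"
    "E (k - 3) * (a i * a j * a l)\<^sup>2 + K * (a i * a j * a l) < E (k - 3) * (x * y * z)\<^sup>2 + K * (x * y * z)"
    using triple_perturbation[OF ne D] by blast
  have F_eq: "F (u\<^sup>2) (v\<^sup>2) (w\<^sup>2) = E k + ((u + v + w)\<^sup>2 - 2 * (u * v + v * w + w * u)) * E (k - 1) +
      (u * v + v * w + w * u)\<^sup>2 * E (k - 2) +
      (E (k - 3) * (u * v * w)\<^sup>2 + (- 2 * (u + v + w) * E (k - 2)) * (u * v * w))" for u v w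
    by (simp add: F_def power2_eq_square algebra_simps)
  have F_less: "F ((a i)\<^sup>2) ((a j)\<^sup>2) ((a l)\<^sup>2) < F (x\<^sup>2) (y\<^sup>2) (z\<^sup>2)"
    unfolding F_eq xyz(1,2) K_def[symmetric] using xyz(3) by simp
  define b where "b = a(i := x, j := y, l := z)"
  have b: "b i = x" "b j = y" "b l = z" "\<And>r. r \<in> R \<Longrightarrow> b r = a r"
    using ijl_ne by (auto simp: b_def R_def)
  have split: "sum f {1..n} = f i + f j + f l + sum f R" for f :: "nat \<Rightarrow> real"
    using I by (simp add: I_def[symmetric] R_def sum.remove[of I i] sum.remove[of "I - {i}" j]
      sum.remove[of "I - {i} - {j}" l] del: One_nat_def)
  have "sum b R = sum a R" "(\<Sum>r\<in>R. (b r)\<^sup>2) = (\<Sum>r\<in>R. (a r)\<^sup>2)"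
    using b(4) by auto
  \<comment> \<open>The sum of squares is s1^2 - 2 s2, so the perturbed point stays on the unit
    sphere.\<close>
  moreover have "x\<^sup>2 + y\<^sup>2 + z\<^sup>2 = (a i)\<^sup>2 + (a j)\<^sup>2 + (a l)\<^sup>2"
  proof -
    have *: "u\<^sup>2 + v\<^sup>2 + w\<^sup>2 = (u + v + w)\<^sup>2 - 2 * (u * v + v * w + w * u)" for u v w :: real
      by (simp add: power2_eq_square algebra_simps)
    show ?thesis unfolding * xyz(1,2) ..
  qed
  moreover have "b \<in> {1..n} \<rightarrow>\<^sub>E UNIV"
    using a ijl by (auto simp: b_def zero_sum_sphere_def PiE_def extensional_def)
  ultimately have "b \<in> zero_sum_sphere n"
    using a xyz(1) by (simp add: zero_sum_sphere_def split b(1-3) del: One_nat_def)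
  then show False
    using max[of b] expand[of b] expand[of a] b F_less by simp
qed

text \<open>A unit vector with zero sum has a positive entry u and a negative entry v, and no third
  value is possible. If they occur p and q times, then p u + q v = 0 and p u^2 + q v^2 = 1 determine
  the squares.\<close>

lemma maximizer_two_values:
  assumes "3 \<le> k" and a: "a \<in> zero_sum_sphere n"
    and max: "\<And>b. b \<in> zero_sum_sphere n \<Longrightarrow> elem_sym n k (\<lambda>r. (b r)\<^sup>2) \<le> elem_sym n k (\<lambda>r. (a r)\<^sup>2)"
    and pos: "0 < elem_sym n k (\<lambda>r. (a r)\<^sup>2)"
  obtains P where "P \<subseteq> {1..n}" "0 < card P" "card P < n"
    "\<And>i. i \<in> {1..n} \<Longrightarrow> (a i)\<^sup>2 =
      (if i \<in> P then real (n - card P) / (real n * card P) else real (card P) / (real n * real (n - card P)))"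
proof -
  define P where "P = {i\<in>{1..n}. 0 < a i}"
  have sums: "(\<Sum>r\<in>{1..n}. (a r)\<^sup>2) = 1" "(\<Sum>r\<in>{1..n}. a r) = 0"
    using a by (auto simp: zero_sum_sphere_def)
  have nz: "\<exists>i\<in>{1..n}. a i \<noteq> 0"
  proof (rule ccontr)
    assume "\<not> ?thesis"
    then have "(\<Sum>r\<in>{1..n}. (a r)\<^sup>2) = 0" by simp
    then show False using sums by simp
  qed
  have "\<exists>i\<in>{1..n}. 0 < a i"
  proof (rule ccontr)
    assume "\<not> ?thesis"
    then have "(\<Sum>r\<in>{1..n}. a r) < (\<Sum>r\<in>{1..n}. 0)"
      using nz by (intro sum_strict_mono_ex1) (force simp: not_less)+
    then show False using sums by simp
  qed
  then obtain i where i: "i \<in> {1..n}" "0 < a i" by blast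
  have "\<exists>i\<in>{1..n}. a i < 0"
  proof (rule ccontr)
    assume "\<not> ?thesis"
    then have "(\<Sum>r\<in>{1..n}. 0) < (\<Sum>r\<in>{1..n}. a r)"
      using nz by (intro sum_strict_mono_ex1) (force simp: not_less)+
    then show False using sums by simp
  qed
  then obtain j where j: "j \<in> {1..n}" "a j < 0" by blast
  have val: "a l = (if l \<in> P then a i else a j)" if "l \<in> {1..n}" for l
    using maximizer_not_three_values[OF assms i(1) j(1) that] i j that by (auto simp: P_def)
  define p q where "p = card P" and "q = n - card P"
  have fin: "finite P" "P \<subseteq> {1..n}" by (auto simp: P_def)
  have "i \<in> P" "j \<notin> P" using i j by (auto simp: P_def)
  then have "0 < p" unfolding p_def using fin by (auto simp: card_gt_0_iff)
  have "P \<subset> {1..n}" using fin \<open>j \<notin> P\<close> j by auto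
  then have "p < n" unfolding p_def using psubset_card_mono[of "{1..n}" P] by simp
  have "0 < q" using \<open>p < n\<close> by (simp add: q_def p_def)
  have n: "real n = real p + real q"
    using \<open>p < n\<close> by (simp add: q_def p_def)
  have cardc: "card ({1..n} - P) = q"
    using fin by (simp add: q_def card_Diff_subset)
  have split: "(\<Sum>r\<in>{1..n}. f (a r)) = real p * f (a i) + real q * f (a j)" for f :: "real \<Rightarrow> real"
  proof -
    have "(\<Sum>r\<in>{1..n}. f (a r)) = (\<Sum>r\<in>{1..n} - P. f (a r)) + (\<Sum>r\<in>P. f (a r))"
      using fin by (intro sum.subset_diff) auto
    also have "(\<Sum>r\<in>{1..n} - P. f (a r)) = (\<Sum>r\<in>{1..n} - P. f (a j))"
      using val by (intro sum.cong) auto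
    also have "(\<Sum>r\<in>P. f (a r)) = (\<Sum>r\<in>P. f (a i))"
      using val fin by (intro sum.cong) auto
    finally show ?thesis by (simp add: cardc p_def del: One_nat_def)
  qed
  have 1: "real p * a i + real q * a j = 0" "real p * (a i)\<^sup>2 + real q * (a j)\<^sup>2 = 1"
    using sums split[of "\<lambda>t. t"] split[of "\<lambda>t. t\<^sup>2"] by auto
  then have "(real p * a i)\<^sup>2 = (real q * a j)\<^sup>2"
    by (metis add_eq_0_iff power2_minus)
  then have 2: "(real p)\<^sup>2 * (a i)\<^sup>2 = (real q)\<^sup>2 * (a j)\<^sup>2"
    by (simp add: power_mult_distrib)
  \<comment> \<open>Since n = p + q, the left side is p^2 u^2 + p q u^2, and p^2 u^2 can be replaced
    by q^2 v^2.\<close>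
  have "(a i)\<^sup>2 * (real n * real p) = real q * (real p * (a i)\<^sup>2 + real q * (a j)\<^sup>2)"
    using 2 by (simp add: n power2_eq_square algebra_simps)
  then have ai: "(a i)\<^sup>2 = real q / (real n * real p)"
    using \<open>0 < p\<close> \<open>p < n\<close> unfolding 1 by (simp add: eq_divide_eq)
  have "(a j)\<^sup>2 * (real n * real q) = real p * (real p * (a i)\<^sup>2 + real q * (a j)\<^sup>2)"
    using 2 by (simp add: n power2_eq_square algebra_simps)
  then have aj: "(a j)\<^sup>2 = real p / (real n * real q)"
    using \<open>0 < q\<close> \<open>p < n\<close> unfolding 1 by (simp add: eq_divide_eq)
  show thesis
  proof (rule that[of P])
    show "(a l)\<^sup>2 = (if l \<in> P then real (n - card P) / (real n * card P)
      else real (card P) / (real n * real (n - card P)))" if "l \<in> {1..n}" for l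
      using val[OF that] ai aj by (simp add: p_def q_def)
  qed (use fin \<open>0 < p\<close> \<open>p < n\<close> in \<open>simp_all add: p_def\<close>)
qed

section \<open>Comparison of two-valued vectors\<close>

text \<open>Only the multiplicities matter, not the positions. An arbitrary set \<open>P\<close> of
  positive entries can therefore be replaced by an initial block.\<close>

lemma esp_poly_two_valued:
  assumes "finite A" "P \<subseteq> A" "\<And>i. i \<in> A \<Longrightarrow> x i = (if i \<in> P then u else v)"
  shows "esp_poly A x = [:1, u:] ^ card P * [:1, v:] ^ (card A - card P)"
proof -
  have "finite P" using assms(1,2) finite_subset by blast
  have "esp_poly A x = (\<Prod>i\<in>A - P. [:1, x i:]) * (\<Prod>i\<in>P. [:1, x i:])"
    unfolding esp_poly_def using assms by (intro prod.subset_diff) auto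
  also have "(\<Prod>i\<in>A - P. [:1, x i:]) = (\<Prod>i\<in>A - P. [:1, v:])"
    using assms by (intro prod.cong) auto
  also have "(\<Prod>i\<in>P. [:1, x i:]) = (\<Prod>i\<in>P. [:1, u:])"
    using assms by (intro prod.cong) auto
  finally show ?thesis
    using assms \<open>finite P\<close> by (simp add: card_Diff_subset mult.commute)
qed

text \<open>The squared entries of a zero-sum unit vector with one positive value in the first
  \<open>p\<close> places and one negative value in the rest.\<close>

definition block_weight :: "nat \<Rightarrow> nat \<Rightarrow> nat \<Rightarrow> real" where
  "block_weight n p r =
    (if r \<le> p then real (n - p) / (real n * real p) else real p / (real n * real (n - p)))"

lemma sum_block:
  fixes u v :: real
  assumes "p \<le> n"
  shows "(\<Sum>r\<in>{1..n}. if r \<le> p then u else v) = real p * u + real (n - p) * v"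
proof -
  have "{1..n} \<inter> {r. r \<le> p} = {1..p}" "{1..n} \<inter> - {r. r \<le> p} = {Suc p..n}"
    using assms by auto
  then show ?thesis by (simp add: sum.If_cases)
qed

lemma sum_block_weight:
  assumes "0 < p" "p < n"
  shows "(\<Sum>r\<in>{1..n}. block_weight n p r) = 1"
proof -
  have "(\<Sum>r\<in>{1..n}. block_weight n p r) = real (n - p) / n + real p / n"
    unfolding block_weight_def using assms by (subst sum_block) auto
  also have "\<dots> = 1"
    using assms by (simp add: add_divide_distrib[symmetric])
  finally show ?thesis .
qed

text \<open>If u_p and v_p denote the two values for \<open>p\<close>, then v_p <= v_m <= u_m <=
  u_p. Passing from \<open>p\<close> to \<open>m\<close> thus lowers the first \<open>p\<close>
  entries and raises all others, also those between \<open>p\<close> and \<open>m\<close>, where v_p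
  becomes u_m.\<close>

lemma elem_sym_block_weight_le:
  assumes "0 < p" "p \<le> m" "2 * m \<le> n"
  shows "elem_sym n k (block_weight n p) \<le> elem_sym n k (block_weight n m)"
  unfolding elem_sym_eq_coeff
proof (rule coeff_esp_poly_majorized_le[where U = "{1..p}" and V = "{Suc p..n}"])
  have pos: "0 < real n" "0 < real p" "0 < real m" "0 < real (n - p)" "0 < real (n - m)"
    "real m \<le> real (n - m)" "real p \<le> real m" "real (n - m) \<le> real (n - p)"
    using assms by auto
  have lo: "real p / (real n * real (n - p)) \<le> real m / (real n * real (n - m))"
    using pos by (intro frac_le mult_left_mono) auto
  have mid: "real m / (real n * real (n - m)) \<le> real (n - m) / (real n * real m)"
    using pos by (intro frac_le mult_left_mono) auto
  have hi: "real (n - m) / (real n * real m) \<le> real (n - p) / (real n * real p)"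
    using pos by (intro frac_le mult_left_mono) auto
  show "block_weight n m i \<le> block_weight n p i" if "i \<in> {1..p}" for i
    using that assms hi by (auto simp: block_weight_def)
  show "block_weight n p i \<le> block_weight n m i" if "i \<in> {Suc p..n}" for i
    using that lo mid by (auto simp: block_weight_def)
  show "block_weight n m j \<le> block_weight n m i" if "i \<in> {1..p}" "j \<in> {Suc p..n}" for i j
    using that assms mid by (auto simp: block_weight_def)
  show "sum (block_weight n p) {1..n} = sum (block_weight n m) {1..n}"
    using assms by (simp only: sum_block_weight)
qed (use assms in \<open>auto simp: block_weight_def\<close>)

lemma esp_poly_block_weight:
  assumes "p \<le> n"
  shows "esp_poly {1..n} (block_weight n p) =
    [:1, real (n - p) / (real n * real p):] ^ p * [:1, real p / (real n * real (n - p)):] ^ (n - p)"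
proof -
  have "{1..p} \<subseteq> {1..n}" using assms by auto
  then show ?thesis
    using esp_poly_two_valued[of "{1..n}" "{1..p}" "block_weight n p"] by (simp add: block_weight_def)
qed

section \<open>Explicit points and the extremal values\<close>

lemma zero_sum_sphere_pairI:
  assumes "2 \<le> n"
  shows "(\<lambda>r\<in>{1..n}. if r = 1 then 1 / sqrt 2 else if r = 2 then - (1 / sqrt 2) else 0)
    \<in> zero_sum_sphere n" (is "?b \<in> _")
proof -
  have "sum f {1..n} = f 1 + f 2" if "\<And>r. r \<in> {1..n} - {1, 2} \<Longrightarrow> f r = 0" for f :: "nat \<Rightarrow> real"
    using that assms by (subst sum.mono_neutral_right[of _ "{1, 2}"]) auto
  from this[of ?b] this[of "\<lambda>r. (?b r)\<^sup>2"] show ?thesis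
    using assms by (auto simp: zero_sum_sphere_def power_divide)
qed

lemma zero_sum_sphere_blockI:
  assumes "0 < p" "p < n"
  shows "(\<lambda>r\<in>{1..n}. if r \<le> p then sqrt (real (n - p) / (real n * real p))
      else - sqrt (real p / (real n * real (n - p)))) \<in> zero_sum_sphere n" (is "?a \<in> _")
proof -
  have "(\<Sum>r\<in>{1..n}. (?a r)\<^sup>2) = (\<Sum>r\<in>{1..n}. block_weight n p r)"
    by (intro sum.cong) (auto simp: block_weight_def)
  moreover have "(\<Sum>r\<in>{1..n}. ?a r) = 0"
  proof -
    \<comment> \<open>The two blocks cancel: the absolute value of each block sum has square p (n -
      p) / n.\<close>
    have "real p * sqrt (real (n - p) / (real n * real p)) =
        sqrt ((real p)\<^sup>2 * (real (n - p) / (real n * real p)))"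
      by (simp only: real_sqrt_mult real_sqrt_abs abs_of_nat)
    also have "(real p)\<^sup>2 * (real (n - p) / (real n * real p)) =
        (real (n - p))\<^sup>2 * (real p / (real n * real (n - p)))"
      using assms by (simp add: power2_eq_square field_simps)
    also have "sqrt \<dots> = real (n - p) * sqrt (real p / (real n * real (n - p)))"
      by (simp only: real_sqrt_mult real_sqrt_abs abs_of_nat)
    finally show ?thesis
      using sum_block[of p n] assms by simp
  qed
  ultimately show ?thesis
    using sum_block_weight[OF assms] by (simp add: zero_sum_sphere_def)
qed

lemma elem_sym_squares_le_block:
  assumes "3 \<le> n" "3 \<le> k" "k \<le> n" "a \<in> zero_sum_sphere n"
  shows "elem_sym n k (\<lambda>r. (a r)\<^sup>2) \<le> elem_sym n k (block_weight n (n div 2))"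
proof -
  define m where "m = n div 2"
  \<comment> \<open>The last bound covers both parities: it yields \<open>n - p \<le> m\<close> once
    \<open>p\<close> exceeds \<open>m\<close>.\<close>
  have m: "0 < m" "m < n" "2 * m \<le> n" "n - m \<le> Suc m" using assms by (auto simp: m_def)
  let ?t = "\<lambda>r\<in>{1..n}. if r \<le> m then sqrt (real (n - m) / (real n * real m))
      else - sqrt (real m / (real n * real (n - m)))"
  obtain c where c: "c \<in> zero_sum_sphere n"
    "\<And>b. b \<in> zero_sum_sphere n \<Longrightarrow> elem_sym n k (\<lambda>r. (b r)\<^sup>2) \<le> elem_sym n k (\<lambda>r. (c r)\<^sup>2)"
    using elem_sym_squares_attains_max[of n k] assms(4) by blast
  \<comment> \<open>The block point has no zero entry, so the maximum is positive, as
    \<open>maximizer_two_values\<close> requires.\<close>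
  have "0 < elem_sym n k (\<lambda>r. (?t r)\<^sup>2)"
    unfolding elem_sym_eq_coeff using m assms by (intro coeff_esp_poly_pos) auto
  also have "\<dots> \<le> elem_sym n k (\<lambda>r. (c r)\<^sup>2)"
    using zero_sum_sphere_blockI[OF m(1,2)] by (rule c(2))
  finally obtain P where P: "P \<subseteq> {1..n}" "0 < card P" "card P < n"
    "\<And>i. i \<in> {1..n} \<Longrightarrow> (c i)\<^sup>2 =
      (if i \<in> P then real (n - card P) / (real n * card P) else real (card P) / (real n * real (n - card P)))"
    using maximizer_two_values[OF assms(2) c] by blast
  define p where "p = card P"
  have poly: "esp_poly {1..n} (\<lambda>r. (c r)\<^sup>2) = esp_poly {1..n} (block_weight n p)"
    using esp_poly_two_valued[OF _ P(1,4)] esp_poly_block_weight[of p n] P(3)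
    by (simp add: p_def del: One_nat_def)
  have "elem_sym n k (\<lambda>r. (c r)\<^sup>2) \<le> elem_sym n k (block_weight n m)"
  proof (cases "p \<le> m")
    case True
    then show ?thesis
      using elem_sym_block_weight_le[of p m n k] P(2) m poly by (simp add: p_def elem_sym_eq_coeff)
  next
    case False
    then have "0 < n - p" "n - p \<le> m" using m P by (auto simp: p_def)
    \<comment> \<open>Exchanging \<open>p\<close> and \<open>n - p\<close> only swaps the two
      factors of the generating polynomial.\<close>
    moreover have "esp_poly {1..n} (block_weight n p) = esp_poly {1..n} (block_weight n (n - p))"
      using P(3) esp_poly_block_weight[of p n] esp_poly_block_weight[of "n - p" n]
      by (simp add: p_def mult.commute del: One_nat_def)
    ultimately show ?thesis
      using elem_sym_block_weight_le[of "n - p" m n k] m poly by (simp add: elem_sym_eq_coeff)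
  qed
  then show ?thesis
    using c(2)[OF assms(4)] by (simp add: m_def)
qed

text \<open>One formula for both parities; the two vectors of the theorem are its simplified
  forms.\<close>

lemma is_arg_max_block:
  assumes "3 \<le> n" "3 \<le> k" "k \<le> n" "p = n div 2"
  shows "is_arg_max (\<lambda>a. elem_sym n k (\<lambda>r. (a r)\<^sup>2)) (\<lambda>a. a \<in> zero_sum_sphere n)
    (\<lambda>r\<in>{1..n}. if r \<le> p then sqrt (real (n - p) / (real n * real p))
      else - sqrt (real p / (real n * real (n - p))))" (is "is_arg_max _ _ ?t")
proof -
  have p: "0 < p" "p < n" using assms by auto
  have "elem_sym n k (\<lambda>r. (?t r)\<^sup>2) = elem_sym n k (block_weight n p)"
    unfolding elem_sym_eq_coeff
    by (intro arg_cong2[where f = coeff] esp_poly_cong) (auto simp: block_weight_def)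
  then show ?thesis
    using elem_sym_squares_le_block[OF assms(1-3)] zero_sum_sphere_blockI[OF p]
    unfolding is_arg_max_def assms(4)[symmetric] by (metis not_less)
qed

theorem theorem5p4:
  fixes n k :: nat
  assumes "n \<ge> 3" and "3 \<le> k" and "k \<le> n"
  shows
    "(even n \<longrightarrow>
        is_arg_max (\<lambda>a. elem_sym n k (\<lambda>r. (a r)\<^sup>2)) (\<lambda>a. a \<in> zero_sum_sphere n)
          (\<lambda>r\<in>{1..n}. if r \<le> n div 2 then 1 / sqrt (real n) else - (1 / sqrt (real n)))) \<and>
     (odd n \<longrightarrow>
        is_arg_max (\<lambda>a. elem_sym n k (\<lambda>r. (a r)\<^sup>2)) (\<lambda>a. a \<in> zero_sum_sphere n)
          (\<lambda>r\<in>{1..n}. if r \<le> (n - 1) div 2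
             then sqrt ((real n + 1) / (real n * (real n - 1)))
             else - sqrt ((real n - 1) / (real n * (real n + 1))))) \<and>
     (let b = (\<lambda>r\<in>{1..n}. if r = 1 then 1 / sqrt 2 else if r = 2 then - (1 / sqrt 2) else 0) in
        is_arg_min (\<lambda>a. elem_sym n k (\<lambda>r. (a r)\<^sup>2)) (\<lambda>a. a \<in> zero_sum_sphere n) b \<and>
        elem_sym n k (\<lambda>r. (b r)\<^sup>2) = 0)"
proof -
  have even_case: "is_arg_max (\<lambda>a. elem_sym n k (\<lambda>r. (a r)\<^sup>2)) (\<lambda>a. a \<in> zero_sum_sphere n)
          (\<lambda>r\<in>{1..n}. if r \<le> n div 2 then 1 / sqrt (real n) else - (1 / sqrt (real n)))"
    if ev: "even n"
  proof -
    obtain m where n: "n = 2 * m" using ev by (elim evenE)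
    have "0 < m" "n - m = m" "n div 2 = m" using assms n by simp_all
    moreover have "real m / (real n * real m) = 1 / real n"
      using \<open>0 < m\<close> by simp
    ultimately show ?thesis
      using is_arg_max_block[OF assms refl] by (simp only: real_sqrt_divide real_sqrt_one)
  qed
  have odd_case: "is_arg_max (\<lambda>a. elem_sym n k (\<lambda>r. (a r)\<^sup>2)) (\<lambda>a. a \<in> zero_sum_sphere n)
          (\<lambda>r\<in>{1..n}. if r \<le> (n - 1) div 2
             then sqrt ((real n + 1) / (real n * (real n - 1)))
             else - sqrt ((real n - 1) / (real n * (real n + 1))))"
    if od: "odd n"
  proof -
    obtain m where n: "n = 2 * m + 1" using od by (elim oddE)
    have "0 < m" using assms n by simp
    \<comment> \<open>Here n + 1 = 2 (n - m) and n - 1 = 2 m, so the factors 2 cancel.\<close>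
    have "(real n + 1) / (real n * (real n - 1)) = real (n - m) / (real n * real m)"
      "(real n - 1) / (real n * (real n + 1)) = real m / (real n * real (n - m))"
      using \<open>0 < m\<close> by (simp_all add: n divide_simps)
    moreover have "(n - 1) div 2 = m" "m = n div 2"
      by (simp_all add: n)
    ultimately show ?thesis
      using is_arg_max_block[OF assms, of m] by (simp only:)
  qed
  define b :: "nat \<Rightarrow> real" where
    "b = (\<lambda>r\<in>{1..n}. if r = 1 then 1 / sqrt 2 else if r = 2 then - (1 / sqrt 2) else 0)"
  have zero: "elem_sym n k (\<lambda>r. (b r)\<^sup>2) = 0"
    unfolding elem_sym_def
  proof (intro sum.neutral ballI)
    fix S assume "S \<in> {S. S \<subseteq> {1..n} \<and> card S = k}"
    then have S: "S \<subseteq> {1..n}" "card S = k" "finite S"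
      by (auto intro: finite_subset)
    \<comment> \<open>Since \<open>k\<close> is at least 3, every product contains a coordinate
      outside the two nonzero ones.\<close>
    have "\<not> S \<subseteq> {1, 2}"
      using card_mono[of "{1, 2 :: nat}" S] S assms by auto
    then obtain i where "i \<in> S" "i \<noteq> 1" "i \<noteq> 2" by blast
    then have "i \<in> S" "(b i)\<^sup>2 = 0"
      using S(1) by (auto simp: b_def)
    then show "(\<Prod>i\<in>S. (b i)\<^sup>2) = 0"
      using S(3) by (intro prod_zero) auto
  qed
  have "b \<in> zero_sum_sphere n"
    unfolding b_def using assms by (intro zero_sum_sphere_pairI) simp
  then have "is_arg_min (\<lambda>a. elem_sym n k (\<lambda>r. (a r)\<^sup>2)) (\<lambda>a. a \<in> zero_sum_sphere n) b"
    by (simp add: is_arg_min_def not_less zero elem_sym_nonneg)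
  with even_case odd_case zero show ?thesis
    unfolding Let_def b_def by blast
qed

end
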